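(* The Greedy Budgeting Rule satisfies proportional justified representation (PJR): for every approval-based election with candidate set $C$, $|C|=m\ge k$, voter set $N$, committee size $k$, and every arrival order of the candidates, the committee $W$ returned by the Greedy Budgeting Rule is such that for each $\ell\in\{1,\dots,k\}$ and each $\ell$-cohesive group of voters $S\subseteq N$ it holds that $\left|\bigcup_{i\in S}A(i)\cap W\right|\ge \ell$.
   Context: An approval-based election consists of a finite set $C$ of $m$ candidates, a set $N=\{1,\dots,n\}$ of voters, a committee size $k$ with $1\le k\le m$, and for each voter $i\in N$ a set $A(i)\subseteq C$ of approved candidates. $N(c)=\{i\in N: c\in A(i)\}$. In the online setting the candidates arrive in a sequence $c_1,\dots,c_m$; when $c_t$ arrives, $N(c_t)$ is revealed, and one must decide immediately and irrevocably whether to select $c_t$, without knowing $N(c_{t'})$ for $t'>t$ (while $n,k,m$ are known). A group $S\subseteq N$ is $\ell$-cohesive if $|S|\ge \ell\cdot n/k$ and $\left|\bigcap_{i\in S}A(i)\right|\ge \ell$. Greedy Budgeting Rule: each voter initially has $1$ dollar. When a candidate $c$ arrives, if the voters in $N(c)$ together have at least $n/k$ dollars left, then $c$ is selected and the voters in $N(c)$ pay a total of exactly $n/k$ dollars (each paying a nonnegative amount not exceeding their remaining money; the cost may be split among the voters of $N(c)$ in an arbitrary way); otherwise $c$ is rejected. If the rule would pick fewer than $k$ candidates in this way, the last arriving candidates are additionally selected so that exactly $k$ candidates are selected (i.e., as soon as the number of candidates still to be decided on, including the current one, equals the number of unfilled seats, all of them are selected). *)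

theory Defs
  imports Complex_Main
begin

text \<open>Voters are the numbers in \<open>{1..n}\<close>; \<open>A i\<close> is the approval set of voter \<open>i\<close>.\<close>

text \<open>At least one voter is required: for \<open>n = 0\<close> the price \<open>n / k\<close> would be zero and the
  empty group would be cohesive.\<close>

definition approval_election :: "'c set \<Rightarrow> nat \<Rightarrow> nat \<Rightarrow> (nat \<Rightarrow> 'c set) \<Rightarrow> bool" where
  "approval_election C n k A \<longleftrightarrow>
     finite C \<and> 1 \<le> n \<and> 1 \<le> k \<and> k \<le> card C \<and> (\<forall>i\<in>{1..n}. A i \<subseteq> C)"

definition arrival_order :: "'c set \<Rightarrow> 'c list \<Rightarrow> bool" where
  "arrival_order C cs \<longleftrightarrow> distinct cs \<and> set cs = C"

definition supporters :: "nat \<Rightarrow> (nat \<Rightarrow> 'c set) \<Rightarrow> 'c \<Rightarrow> nat set" where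
  "supporters n A c = {i \<in> {1..n}. c \<in> A i}"

definition cohesive :: "nat \<Rightarrow> nat \<Rightarrow> (nat \<Rightarrow> 'c set) \<Rightarrow> nat \<Rightarrow> nat set \<Rightarrow> bool" where
  "cohesive n k A l S \<longleftrightarrow>
     S \<subseteq> {1..n} \<and> real (card S) \<ge> real l * (real n / real k) \<and> card (\<Inter>i\<in>S. A i) \<ge> l"

definition PJR :: "nat \<Rightarrow> nat \<Rightarrow> (nat \<Rightarrow> 'c set) \<Rightarrow> 'c set \<Rightarrow> bool" where
  "PJR n k A W \<longleftrightarrow>
     (\<forall>l\<in>{1..k}. \<forall>S. cohesive n k A l S \<longrightarrow> card ((\<Union>i\<in>S. A i) \<inter> W) \<ge> l)"

text \<open>\<open>p i\<close> is the amount that voter \<open>i\<close> pays for \<open>c\<close> out of the remaining money \<open>b i\<close>.\<close>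

definition valid_payment ::
    "nat \<Rightarrow> nat \<Rightarrow> (nat \<Rightarrow> 'c set) \<Rightarrow> (nat \<Rightarrow> real) \<Rightarrow> 'c \<Rightarrow> (nat \<Rightarrow> real) \<Rightarrow> bool" where
  "valid_payment n k A b c p \<longleftrightarrow>
     (\<forall>i\<in>supporters n A c. 0 \<le> p i \<and> p i \<le> b i) \<and>
     (\<forall>i. i \<notin> supporters n A c \<longrightarrow> p i = 0) \<and>
     (\<Sum>i\<in>supporters n A c. p i) = real n / real k"

text \<open>\<open>greedy_run n k A b W cs W'\<close>: if the remaining budgets are \<open>b\<close>, the candidates selected
  so far are \<open>W\<close> and those still to arrive are \<open>cs\<close>, then \<open>W'\<close> is a possible final committee.
  It is a relation because the payments may be split arbitrarily. In a state with
  \<open>card W + length (c # cs) = k\<close>, all remaining candidates are needed to fill the seats; this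
  equation then persists until the end, so budgets no longer matter and need not be updated.
  No explicit bound by \<open>k\<close> is imposed: \<open>k\<close> purchases use up the total money \<open>n\<close>.\<close>

inductive greedy_run ::
    "nat \<Rightarrow> nat \<Rightarrow> (nat \<Rightarrow> 'c set) \<Rightarrow> (nat \<Rightarrow> real) \<Rightarrow> 'c set \<Rightarrow> 'c list \<Rightarrow> 'c set \<Rightarrow> bool"
  for n :: nat and k :: nat and A :: "nat \<Rightarrow> 'c set" where
  finish: "greedy_run n k A b W [] W"
| fill: "\<lbrakk>card W + length (c # cs) = k;
    greedy_run n k A b (insert c W) cs W'\<rbrakk>
    \<Longrightarrow> greedy_run n k A b W (c # cs) W'"
| buy: "\<lbrakk>card W + length (c # cs) \<noteq> k;
    (\<Sum>i\<in>supporters n A c. b i) \<ge> real n / real k;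
    valid_payment n k A b c p;
    greedy_run n k A (\<lambda>i. b i - p i) (insert c W) cs W'\<rbrakk>
    \<Longrightarrow> greedy_run n k A b W (c # cs) W'"
| reject: "\<lbrakk>card W + length (c # cs) \<noteq> k;
    (\<Sum>i\<in>supporters n A c. b i) < real n / real k;
    greedy_run n k A b W cs W'\<rbrakk>
    \<Longrightarrow> greedy_run n k A b W (c # cs) W'"

definition greedy_budgeting_committee ::
    "nat \<Rightarrow> nat \<Rightarrow> (nat \<Rightarrow> 'c set) \<Rightarrow> 'c list \<Rightarrow> 'c set \<Rightarrow> bool" where
  "greedy_budgeting_committee n k A cs W \<longleftrightarrow> greedy_run n k A (\<lambda>_. 1) {} cs W"

end

theory Submission
  imports Defs
begin

text \<open>Let \<open>U\<close> be the union of the approval sets of the group \<open>S\<close>. The members of \<open>S\<close> spend money only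
  on candidates in \<open>U\<close>, and at most \<open>n / k\<close> on each. So as long as fewer than \<open>l\<close> candidates
  of \<open>U\<close> have been selected, \<open>S\<close> still owns \<open>n / k\<close> dollars and can afford every arriving
  candidate that it approves unanimously. Hence either \<open>l\<close> candidates of \<open>U\<close> are selected or all
  (at least \<open>l\<close>) unanimously approved candidates are.\<close>

lemma finite_supporters [simp]: "finite (supporters n A c)"
  by (simp add: supporters_def)

lemma greedy_run_mono:
  assumes "greedy_run n k A b W cs W'"
  shows "W \<subseteq> W'"
  using assms by induction auto

lemma greedy_run_finite:
  assumes "greedy_run n k A b W cs W'" "finite W"
  shows "finite W'"
  using assms by induction auto

lemma valid_payment_nonneg:
  assumes "valid_payment n k A b c p"
  shows "0 \<le> p i"
  using assms by (cases "i \<in> supporters n A c") (auto simp: valid_payment_def)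

text \<open>Payments are nonnegative, vanish outside \<open>supporters n A c\<close> and total
  \<open>n / k\<close>; if no member of \<open>S\<close> approves \<open>c\<close>, none of them
  pays.\<close>

lemma valid_payment_sum_le:
  assumes "valid_payment n k A b c p" "S \<subseteq> {1..n}"
  shows "sum p S \<le> (if c \<in> (\<Union>i\<in>S. A i) then real n / real k else 0)"
proof (cases "c \<in> (\<Union>i\<in>S. A i)")
  case True
  have "finite S"
    using assms(2) finite_subset by blast
  then have "sum p S = sum p (S \<inter> supporters n A c)"
    using assms(1) by (intro sum.mono_neutral_right) (auto simp: valid_payment_def)
  also have "\<dots> \<le> sum p (supporters n A c)"
    using valid_payment_nonneg[OF assms(1)] by (intro sum_mono2) auto
  finally show ?thesis
    using True assms(1) by (simp add: valid_payment_def)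
next
  case False
  then have "p i = 0" if "i \<in> S" for i
    using that assms(1) by (auto simp: valid_payment_def supporters_def)
  then show ?thesis
    using False by simp
qed

lemma card_Int_insert:
  assumes "finite W" "c \<notin> W"
  shows "card (U \<inter> insert c W) = card (U \<inter> W) + (if c \<in> U then 1 else 0)"
  using assms by simp

text \<open>Stated for an arbitrary state so that induction over the run applies. The last
  hypothesis is the invariant: the money left to \<open>S\<close>, plus one price per selected
  candidate of the union, covers \<open>l\<close> prices.\<close>

lemma greedy_run_unanimous_selected:
  assumes "greedy_run n k A b W cs W'"
    and "S \<subseteq> {1..n}"
    and "finite W" "distinct cs" "set cs \<inter> W = {}"
    and "\<forall>i\<in>{1..n}. 0 \<le> b i"
    and "real l * (real n / real k)
      \<le> sum b S + real (card ((\<Union>i\<in>S. A i) \<inter> W)) * (real n / real k)"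
  shows "card ((\<Union>i\<in>S. A i) \<inter> W') \<ge> l \<or> (\<Inter>i\<in>S. A i) \<inter> set cs \<subseteq> W'"
  using assms
proof (induction rule: greedy_run.induct)
  case (finish b W)
  then show ?case by simp
next
  case (fill W c cs b W')
  let ?U = "\<Union>i\<in>S. A i"
  \<comment> \<open>Filling leaves \<open>b\<close> unchanged and can only raise the count, so the
    invariant survives.\<close>
  have "real (card (?U \<inter> W)) * (real n / real k)
      \<le> real (card (?U \<inter> insert c W)) * (real n / real k)"
    using fill.prems by (intro mult_right_mono) (auto intro!: card_mono)
  then have "card (?U \<inter> W') \<ge> l \<or> (\<Inter>i\<in>S. A i) \<inter> set cs \<subseteq> W'"
    using fill.prems by (intro fill.IH) auto
  then show ?case
    using greedy_run_mono[OF fill.hyps(2)] by auto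
next
  case (buy W c cs b p W')
  let ?U = "\<Union>i\<in>S. A i"
  have nonneg: "\<forall>i\<in>{1..n}. 0 \<le> b i - p i"
    using buy.prems(5) buy.hyps(3)
    by (metis diff_ge_0_iff_ge valid_payment_def)
  \<comment> \<open>As \<open>c\<close> is new, the count rises by exactly one whenever
    \<open>S\<close> may have to pay; this offsets its loss of at most \<open>n / k\<close>.\<close>
  have "card (?U \<inter> insert c W) = card (?U \<inter> W) + (if c \<in> ?U then 1 else 0)"
    using buy.prems by (intro card_Int_insert) auto
  then have "real (card (?U \<inter> insert c W)) * (real n / real k)
      = real (card (?U \<inter> W)) * (real n / real k) + (if c \<in> ?U then real n / real k else 0)"
    by (cases "c \<in> ?U") (simp_all only: if_True if_False of_nat_add of_nat_1 distrib_right
      mult_1 add_0_right)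
  moreover have "(\<Sum>i\<in>S. b i - p i) = sum b S - sum p S"
    by (rule sum_subtractf)
  ultimately have "real l * (real n / real k) \<le> (\<Sum>i\<in>S. b i - p i)
      + real (card (?U \<inter> insert c W)) * (real n / real k)"
    using buy.prems(6) valid_payment_sum_le[OF buy.hyps(3) buy.prems(1)] by linarith
  then have "card (?U \<inter> W') \<ge> l \<or> (\<Inter>i\<in>S. A i) \<inter> set cs \<subseteq> W'"
    using buy.prems nonneg by (intro buy.IH) auto
  then show ?case
    using greedy_run_mono[OF buy.hyps(4)] by auto
next
  case (reject W c cs b W')
  let ?U = "\<Union>i\<in>S. A i"
  have IH: "card (?U \<inter> W') \<ge> l \<or> (\<Inter>i\<in>S. A i) \<inter> set cs \<subseteq> W'"
    using reject.prems by (intro reject.IH) auto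
  show ?case
  proof (cases "c \<in> (\<Inter>i\<in>S. A i)")
    case True
    \<comment> \<open>All of \<open>S\<close> supports \<open>c\<close>, and the other supporters
      have nonnegative budgets. Rejection thus leaves \<open>S\<close> with less than one
      price.\<close>
    have "sum b S \<le> sum b (supporters n A c)"
      using True reject.prems(1,5) by (intro sum_mono2) (auto simp: supporters_def)
    then have "real l * (real n / real k)
        < (1 + real (card (?U \<inter> W))) * (real n / real k)"
      using reject.hyps(2) reject.prems(6) unfolding distrib_right mult_1 by linarith
    then have "real l < 1 + real (card (?U \<inter> W))"
      by (rule mult_right_less_imp_less) simp
    then have "l \<le> card (?U \<inter> W)"
      by linarith
    also have "\<dots> \<le> card (?U \<inter> W')"
      using greedy_run_finite[OF reject.hyps(3) reject.prems(2)] greedy_run_mono[OF reject.hyps(3)]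
      by (intro card_mono) auto
    finally show ?thesis by simp
  next
    case False
    then show ?thesis using IH by auto
  qed
qed

theorem theorem5p1:
  fixes C :: "'c set" and n k :: nat and A :: "nat \<Rightarrow> 'c set" and cs :: "'c list" and W :: "'c set"
  assumes "approval_election C n k A"
    and "arrival_order C cs"
    and "greedy_budgeting_committee n k A cs W"
  shows "PJR n k A W"
  unfolding PJR_def
proof (intro ballI allI impI)
  fix l S
  assume l: "l \<in> {1..k}" and coh: "cohesive n k A l S"
  have run: "greedy_run n k A (\<lambda>_. 1) {} cs W"
    using assms(3) by (simp add: greedy_budgeting_committee_def)
  have S: "S \<subseteq> {1..n}" "real l * (real n / real k) \<le> real (card S)" "l \<le> card (\<Inter>i\<in>S. A i)"
    using coh by (auto simp: cohesive_def)
  \<comment> \<open>A member \<open>j\<close> of \<open>S\<close> is needed: it places the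
    intersection inside \<open>A j\<close>, hence among the arriving candidates and inside the
    union.\<close>
  have "0 < real l * (real n / real k)"
    using l assms(1) by (simp add: approval_election_def)
  then have "S \<noteq> {}"
    using S(2) by auto
  then obtain j where j: "j \<in> S" by blast
  \<comment> \<open>Initially \<open>S\<close> owns \<open>card S\<close> dollars and nothing is
    selected, so the invariant is the size condition of cohesiveness.\<close>
  have "card ((\<Union>i\<in>S. A i) \<inter> W) \<ge> l \<or> (\<Inter>i\<in>S. A i) \<inter> set cs \<subseteq> W"
    using run S assms(2) by (intro greedy_run_unanimous_selected) (auto simp: arrival_order_def)
  then show "card ((\<Union>i\<in>S. A i) \<inter> W) \<ge> l"
  proof
    assume *: "(\<Inter>i\<in>S. A i) \<inter> set cs \<subseteq> W"
    have "A j \<subseteq> set cs"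
      using j S(1) assms(1,2) by (auto simp: approval_election_def arrival_order_def)
    then have "(\<Inter>i\<in>S. A i) \<subseteq> (\<Union>i\<in>S. A i) \<inter> W"
      using j * by blast
    then have "card (\<Inter>i\<in>S. A i) \<le> card ((\<Union>i\<in>S. A i) \<inter> W)"
      using greedy_run_finite[OF run] by (intro card_mono) auto
    then show ?thesis
      using S(3) by simp
  qed
qed

end
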